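(* Let $K$ be a finite field, let $v_1,\ldots,v_s\in\mathbb{N}^n$, let $X^*\subset K^s$ be the affine algebraic toric set parameterized by $y^{v_1},\ldots,y^{v_s}$, and let $Y\subset\mathbb{P}^s$ be the image of $X^*$ under the map $x\mapsto[(x,1)]$. Let $S=K[t_1,\ldots,t_s]$ and let $S[u]=K[t_1,\ldots,t_s,u]$, equipped with the monomial order $\succ$ (and $S$ with its restriction). If $f_1,\ldots,f_r$ is a Gröbner basis of $I(X^* )$ with respect to $\succ$, then $f_1^h,\ldots,f_r^h$ form a Gröbner basis with respect to $\succ$ (of the ideal they generate in $S[u]$) and $$ I(Y)=I(X^* )^h=(f_1^h,\ldots,f_r^h). $$
   Context: $\mathbb{N}$ contains $0$ and $K^*=K\setminus\{0\}$. For $v_i=(v_{i1},\ldots,v_{in})\in\mathbb{N}^n$, $y^{v_i}=y_1^{v_{i1}}\cdots y_n^{v_{in}}$. The affine algebraic toric set parameterized by $y^{v_1},\ldots,y^{v_s}$ is $$X^*=\{(x_1^{v_{11}}\cdots x_n^{v_{1n}},\ldots,x_1^{v_{s1}}\cdots x_n^{v_{sn}})\in K^s\mid x_1,\ldots,x_n\in K^*\}.$$ $I(X^* )\subset S$ is the ideal of all polynomials vanishing on $X^*$. $I(Y)\subset S[u]$ is the ideal generated by the homogeneous polynomials (standard grading) vanishing on $Y$. For $f\in S$ of degree $e$, its homogenization is $f^h=u^ef(t_1/u,\ldots,t_s/u)\in S[u]$ (with $0^h=0$). The homogenization of $I(X^* )$ is the ideal $I(X^* )^h=(\{f^h\mid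 f\in I(X^* )\})$ of $S[u]$. Monomial order: put $u=t_{s+1}$. For monomials $t^a,t^b$ of $S[u]$ with $a,b\in\mathbb{N}^{s+1}$, $t^b\succ t^a$ if and only if the total degree of $t^b$ in $t_1,\ldots,t_{s+1}$ is greater than that of $t^a$, or both degrees are equal and the last nonzero component of $b-a$ is negative. *)

theory Defs
  imports "HOL-Library.Poly_Mapping" "HOL-Library.FuncSet" "HOL-Algebra.Ideal"
begin

text \<open>
  The variables are indexed by positive naturals. A monomial is its finitely supported exponent
  vector, and polynomials in infinitely many variables form a single type; the polynomial ring in
  the first m variables is cut out of it as a ring with carrier. Thus for
  \<open>S = mpoly_ring s\<close> and \<open>S[u] = mpoly_ring (Suc s)\<close>, with \<open>u\<close> the variable of index
  \<open>Suc s\<close>, the inclusion of \<open>S\<close> in \<open>S[u]\<close> is an inclusion of carriers.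
\<close>

type_synonym expo = "nat \<Rightarrow>\<^sub>0 nat"
type_synonym 'k mpol = "expo \<Rightarrow>\<^sub>0 'k"

definition mpoly_ring :: "nat \<Rightarrow> ('k::field) mpol ring" where
  "mpoly_ring m =
     \<lparr>carrier = {p. \<forall>a\<in>Poly_Mapping.keys p. Poly_Mapping.keys a \<subseteq> {1..m}},
      monoid.mult = (*), one = 1, zero = 0, add = (+)\<rparr>"

definition mdeg :: "expo \<Rightarrow> nat" where
  "mdeg a = (\<Sum>i\<in>Poly_Mapping.keys a. Poly_Mapping.lookup a i)"

text \<open>Only meaningful for nonzero polynomials.\<close>

definition tdeg :: "('k::field) mpol \<Rightarrow> nat" where
  "tdeg f = Max (mdeg ` Poly_Mapping.keys f)"

definition homogeneous :: "('k::field) mpol \<Rightarrow> bool" where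
  "homogeneous f \<longleftrightarrow> (\<exists>d. \<forall>a\<in>Poly_Mapping.keys f. mdeg a = d)"

definition mpoly_eval :: "('k::field) mpol \<Rightarrow> (nat \<Rightarrow> 'k) \<Rightarrow> 'k" where
  "mpoly_eval f x =
     (\<Sum>a\<in>Poly_Mapping.keys f. Poly_Mapping.lookup f a *
        (\<Prod>i\<in>Poly_Mapping.keys a. x i ^ Poly_Mapping.lookup a i))"

definition affine_space :: "nat \<Rightarrow> (nat \<Rightarrow> 'k::field) set" where
  "affine_space m = {1..m} \<rightarrow>\<^sub>E UNIV"

definition toric_set :: "nat \<Rightarrow> nat \<Rightarrow> (nat \<Rightarrow> nat \<Rightarrow> nat) \<Rightarrow> (nat \<Rightarrow> 'k::field) set" where
  "toric_set s n v =
     {(\<lambda>i\<in>{1..s}. \<Prod>j=1..n. x j ^ v i j) | x. \<forall>j\<in>{1..n}. x j \<noteq> 0}"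

definition vanishing_ideal :: "nat \<Rightarrow> (nat \<Rightarrow> 'k::field) set \<Rightarrow> 'k mpol set" where
  "vanishing_ideal s X = {f \<in> carrier (mpoly_ring s). \<forall>x\<in>X. mpoly_eval f x = 0}"

text \<open>The points of the projective space of dimension \<open>s\<close> are the classes of \<open>proj_rel s\<close>.\<close>

definition proj_rel :: "nat \<Rightarrow> ((nat \<Rightarrow> 'k::field) \<times> (nat \<Rightarrow> 'k)) set" where
  "proj_rel s =
     {(z, w). z \<in> affine_space (Suc s) - {\<lambda>i\<in>{1..Suc s}. 0} \<and>
              w \<in> affine_space (Suc s) - {\<lambda>i\<in>{1..Suc s}. 0} \<and>
              (\<exists>c. c \<noteq> 0 \<and> w = (\<lambda>i\<in>{1..Suc s}. c * z i))}"

definition proj_space :: "nat \<Rightarrow> (nat \<Rightarrow> 'k::field) set set" where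
  "proj_space s = (affine_space (Suc s) - {\<lambda>i\<in>{1..Suc s}. 0}) // proj_rel s"

definition proj_point :: "nat \<Rightarrow> (nat \<Rightarrow> 'k::field) \<Rightarrow> (nat \<Rightarrow> 'k) set" where
  "proj_point s z = proj_rel s `` {z}"

text \<open>The map sending \<open>x\<close> to the projective point \<open>[(x, 1)]\<close>.\<close>

definition to_proj :: "nat \<Rightarrow> (nat \<Rightarrow> 'k::field) \<Rightarrow> (nat \<Rightarrow> 'k) set" where
  "to_proj s x = proj_point s (x(Suc s := 1))"

text \<open>
  A homogeneous polynomial vanishes at a projective point if it vanishes at its representatives;
  for homogeneous polynomials, all representatives agree on this.
\<close>

definition proj_vanishing_ideal :: "nat \<Rightarrow> (nat \<Rightarrow> 'k::field) set set \<Rightarrow> 'k mpol set" where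
  "proj_vanishing_ideal s Y =
     Idl\<^bsub>mpoly_ring (Suc s)\<^esub>
       {f \<in> carrier (mpoly_ring (Suc s)). homogeneous f \<and> (\<forall>P\<in>Y. \<forall>z\<in>P. mpoly_eval f z = 0)}"

text \<open>
  With \<open>e = tdeg f\<close>, each term \<open>c t\<^sup>a\<close> of \<open>f\<close> contributes
  \<open>u\<^sup>e c (t/u)\<^sup>a = c t\<^sup>a u\<^sup>k\<close>, where \<open>k = e - mdeg a\<close>. The zero polynomial is sent to \<open>0\<close>.
\<close>

definition homogenize :: "nat \<Rightarrow> ('k::field) mpol \<Rightarrow> 'k mpol" where
  "homogenize s f =
     (\<Sum>a\<in>Poly_Mapping.keys f.
        Poly_Mapping.single (a + Poly_Mapping.single (Suc s) (tdeg f - mdeg a))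
          (Poly_Mapping.lookup f a))"

definition homogenize_ideal :: "nat \<Rightarrow> ('k::field) mpol set \<Rightarrow> 'k mpol set" where
  "homogenize_ideal s I = Idl\<^bsub>mpoly_ring (Suc s)\<^esub> (homogenize s ` I)"

text \<open>
  The number of variables need not be mentioned: exponents of absent variables are \<open>0\<close>. In
  particular the order on \<open>S\<close> is the restriction of the one on \<open>S[u]\<close>.
\<close>

definition mon_greater :: "expo \<Rightarrow> expo \<Rightarrow> bool" (infix "\<succ>\<^sub>m" 50) where
  "b \<succ>\<^sub>m a \<longleftrightarrow> mdeg b > mdeg a \<or>
     (mdeg b = mdeg a \<and>
      (\<exists>i. int (Poly_Mapping.lookup b i) - int (Poly_Mapping.lookup a i) < 0 \<and>
           (\<forall>j>i. int (Poly_Mapping.lookup b j) - int (Poly_Mapping.lookup a j) = 0)))"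

text \<open>Only meaningful for nonzero polynomials.\<close>

definition lead_expo :: "('k::field) mpol \<Rightarrow> expo" where
  "lead_expo f =
     (THE b. b \<in> Poly_Mapping.keys f \<and> (\<forall>a\<in>Poly_Mapping.keys f. a \<noteq> b \<longrightarrow> b \<succ>\<^sub>m a))"

definition lead_monom :: "('k::field) mpol \<Rightarrow> 'k mpol" where
  "lead_monom f = Poly_Mapping.single (lead_expo f) 1"

definition initial_ideal :: "nat \<Rightarrow> ('k::field) mpol set \<Rightarrow> 'k mpol set" where
  "initial_ideal m A = Idl\<^bsub>mpoly_ring m\<^esub> (lead_monom ` (A - {0}))"

text \<open>Zero is allowed as a (redundant) member of a Groebner basis.\<close>

definition groebner_basis :: "nat \<Rightarrow> ('k::field) mpol set \<Rightarrow> 'k mpol set \<Rightarrow> bool" where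
  "groebner_basis m I G \<longleftrightarrow>
     ideal I (mpoly_ring m) \<and> finite G \<and> G \<subseteq> I \<and> initial_ideal m G = initial_ideal m I"

lemma keys_mult_carrier:
  assumes "\<forall>a\<in>Poly_Mapping.keys p. Poly_Mapping.keys a \<subseteq> V"
    and "\<forall>a\<in>Poly_Mapping.keys q. Poly_Mapping.keys a \<subseteq> V"
  shows "\<forall>a\<in>Poly_Mapping.keys (p * q :: ('k::field) mpol). Poly_Mapping.keys a \<subseteq> V"
proof
  fix a assume "a \<in> Poly_Mapping.keys (p * q)"
  then obtain b c where "a = b + c" "b \<in> Poly_Mapping.keys p" "c \<in> Poly_Mapping.keys q"
    using keys_mult[of p q] by blast
  then show "Poly_Mapping.keys a \<subseteq> V"
    using assms Poly_Mapping.keys_add[of b c] by blast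
qed

lemma cring_mpoly_ring: "cring (mpoly_ring m :: ('k::field) mpol ring)"
proof (rule cringI)
  show "abelian_group (mpoly_ring m :: 'k mpol ring)"
  proof (rule abelian_groupI)
    fix x y :: "'k mpol"
    assume "x \<in> carrier (mpoly_ring m)" "y \<in> carrier (mpoly_ring m)"
    then show "x \<oplus>\<^bsub>mpoly_ring m\<^esub> y \<in> carrier (mpoly_ring m)"
      using Poly_Mapping.keys_add[of x y] by (auto simp: mpoly_ring_def)
  next
    fix x :: "'k mpol"
    assume "x \<in> carrier (mpoly_ring m)"
    then show "\<exists>y\<in>carrier (mpoly_ring m). y \<oplus>\<^bsub>mpoly_ring m\<^esub> x = \<zero>\<^bsub>mpoly_ring m\<^esub>"
      by (intro bexI[of _ "- x"]) (auto simp: mpoly_ring_def)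
  qed (auto simp: mpoly_ring_def add_ac)
  show "comm_monoid (mpoly_ring m :: 'k mpol ring)"
  proof (rule comm_monoidI)
    fix x y :: "'k mpol"
    assume "x \<in> carrier (mpoly_ring m)" "y \<in> carrier (mpoly_ring m)"
    then show "x \<otimes>\<^bsub>mpoly_ring m\<^esub> y \<in> carrier (mpoly_ring m)"
      using keys_mult_carrier[of x "{1..m}" y] by (auto simp: mpoly_ring_def)
  qed (auto simp: mpoly_ring_def mult_ac)
qed (simp add: mpoly_ring_def distrib_right)

lemma mon_greater_total:
  assumes "a \<noteq> b"
  shows "b \<succ>\<^sub>m a \<or> a \<succ>\<^sub>m b"
proof -
  let ?D = "{i. Poly_Mapping.lookup b i \<noteq> Poly_Mapping.lookup a i}"
  have "?D \<subseteq> Poly_Mapping.keys a \<union> Poly_Mapping.keys b"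
    by (auto simp: in_keys_iff)
  then have fin: "finite ?D"
    by (rule finite_subset) simp
  obtain k where "k \<in> ?D"
    using assms poly_mapping_eqI[of a b] by force
  then have "?D \<noteq> {}"
    by blast
  with fin have "Max ?D \<in> ?D"
    by (rule Max_in)
  moreover have "Poly_Mapping.lookup b j = Poly_Mapping.lookup a j" if "j > Max ?D" for j
    using Max_ge[OF fin, of j] that by fastforce
  ultimately have
    "\<exists>i. Poly_Mapping.lookup b i \<noteq> Poly_Mapping.lookup a i \<and>
         (\<forall>j>i. Poly_Mapping.lookup b j = Poly_Mapping.lookup a j)"
    by blast
  then obtain i where i: "Poly_Mapping.lookup b i \<noteq> Poly_Mapping.lookup a i"
    "\<forall>j>i. Poly_Mapping.lookup b j = Poly_Mapping.lookup a j"
    by blast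
  show ?thesis
  proof (cases "Poly_Mapping.lookup b i < Poly_Mapping.lookup a i")
    case True
    then have "int (Poly_Mapping.lookup b i) - int (Poly_Mapping.lookup a i) < 0 \<and>
      (\<forall>j>i. int (Poly_Mapping.lookup b j) - int (Poly_Mapping.lookup a j) = 0)"
      using i(2) by simp
    then show ?thesis
      unfolding mon_greater_def using linorder_neqE_nat by blast
  next
    case False
    then have "int (Poly_Mapping.lookup a i) - int (Poly_Mapping.lookup b i) < 0 \<and>
      (\<forall>j>i. int (Poly_Mapping.lookup a j) - int (Poly_Mapping.lookup b j) = 0)"
      using i by simp
    then show ?thesis
      unfolding mon_greater_def using linorder_neqE_nat by metis
  qed
qed

lemma to_proj_in_proj_space:
  assumes "x \<in> affine_space s"
  shows "to_proj s x \<in> proj_space s"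
proof -
  have "x(Suc s := 1) \<in> affine_space (Suc s)"
    using assms by (auto simp: affine_space_def PiE_iff extensional_def)
  moreover have "x(Suc s := 1) \<noteq> (\<lambda>i\<in>{1..Suc s}. 0)"
    by (auto dest: fun_cong[where x = "Suc s"])
  ultimately show ?thesis
    unfolding to_proj_def proj_point_def proj_space_def by (intro quotientI) blast
qed

end

theory Submission
  imports Defs
begin

text \<open>
  A homogeneous polynomial \<open>F\<close> of degree \<open>d\<close> is \<open>u\<^sup>k g\<^sup>h\<close>, where \<open>g\<close> is its value at \<open>u = 1\<close> and
  \<open>k\<close> is \<open>d\<close> minus the degree of \<open>g\<close>; moreover \<open>F\<close> vanishes at \<open>[(x, 1)]\<close> iff \<open>g\<close> vanishes at
  \<open>x\<close>, whence \<open>I(Y) = I(X)\<^sup>h\<close>. Since the order compares degrees first and \<open>u\<close> is its smallest variable,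
  \<open>g\<close> and \<open>g\<^sup>h\<close> have the same leading monomial. Hence division of \<open>f \<in> I\<close> by a Groebner basis \<open>G\<close>
  of \<open>I\<close> homogenizes to a representation of \<open>f\<^sup>h\<close> over \<open>G\<^sup>h\<close>. If \<open>F\<close> lies in the ideal
  generated by \<open>G\<^sup>h\<close>, then each homogeneous component of \<open>F\<close>, evaluated at \<open>u = 1\<close>, lies in \<open>I\<close>,
  so the leading monomial of \<open>F\<close> is divisible by that of some \<open>g\<^sup>h\<close> with \<open>g \<in> G\<close>.
\<close>

abbreviation keys :: "('a \<Rightarrow>\<^sub>0 'b::zero) \<Rightarrow> 'a set" where
  "keys \<equiv> Poly_Mapping.keys"

abbreviation lookup :: "('a \<Rightarrow>\<^sub>0 'b::zero) \<Rightarrow> 'a \<Rightarrow> 'b" where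
  "lookup \<equiv> Poly_Mapping.lookup"

abbreviation single :: "'a \<Rightarrow> 'b \<Rightarrow> 'a \<Rightarrow>\<^sub>0 'b::zero" where
  "single \<equiv> Poly_Mapping.single"

section \<open>Exponents and the monomial order\<close>

lemma mdeg_eq_sum:
  assumes "finite A" "keys a \<subseteq> A"
  shows "mdeg a = sum (lookup a) A"
  unfolding mdeg_def using assms by (intro sum.mono_neutral_left) (auto simp: in_keys_iff)

lemma keys_add_expo: "keys (a + b :: expo) = keys a \<union> keys b"
  by (auto simp: in_keys_iff lookup_add)

lemma mdeg_add: "mdeg (a + b) = mdeg a + mdeg b"
  using mdeg_eq_sum[of "keys a \<union> keys b"]
  by (simp add: keys_add_expo lookup_add sum.distrib)

lemma mdeg_single: "mdeg (single i k) = k"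
  by (simp add: mdeg_def)

lemma lookup_le_mdeg: "lookup a i \<le> mdeg a"
proof (cases "i \<in> keys a")
  case True
  then show ?thesis unfolding mdeg_def by (intro member_le_sum) auto
qed (simp add: in_keys_iff)

text \<open>An exponent is determined by its coordinate function, which takes values in
  \<open>{0..d}\<close> on \<open>A\<close> and is 0 elsewhere.\<close>

lemma finite_expo_bounded:
  assumes "finite A"
  shows "finite {a :: expo. keys a \<subseteq> A \<and> mdeg a \<le> d}" (is "finite ?S")
proof (rule finite_imageD)
  have "lookup ` ?S \<subseteq> {f. \<forall>i. (i \<in> A \<longrightarrow> f i \<in> {0..d}) \<and> (i \<notin> A \<longrightarrow> f i = 0)}"
  proof (rule image_subsetI, rule CollectI, intro allI conjI impI)
    fix a i assume a: "a \<in> ?S"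
    show "lookup a i \<in> {0..d}"
      using a lookup_le_mdeg[of a i] by simp
    assume "i \<notin> A"
    then have "i \<notin> keys a" using a by blast
    then show "lookup a i = 0" by (simp add: in_keys_iff)
  qed
  then show "finite (lookup ` ?S)"
    using finite_set_of_finite_funs[OF assms, of "{0..d}" 0] finite_subset by blast
  show "inj_on lookup ?S"
    by (rule inj_onI) (rule poly_mapping_eqI, simp)
qed

lemma mon_greater_iff:
  "b \<succ>\<^sub>m a \<longleftrightarrow> mdeg b > mdeg a \<or>
     (mdeg b = mdeg a \<and> (\<exists>i. lookup b i < lookup a i \<and> (\<forall>j>i. lookup b j = lookup a j)))"
  by (simp add: mon_greater_def)

lemma mon_greater_irrefl: "\<not> a \<succ>\<^sub>m a"
  by (simp add: mon_greater_iff)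

lemma mon_greater_trans:
  assumes "a \<succ>\<^sub>m b" "b \<succ>\<^sub>m c"
  shows "a \<succ>\<^sub>m c"
proof (cases "mdeg a = mdeg b \<and> mdeg b = mdeg c")
  case True
  then obtain i j where i: "lookup a i < lookup b i" "\<forall>k>i. lookup a k = lookup b k"
    and j: "lookup b j < lookup c j" "\<forall>k>j. lookup b k = lookup c k"
    using assms by (auto simp: mon_greater_iff)
  \<comment> \<open>The later of the two deciding positions decides the comparison of
    \<open>a\<close> with \<open>c\<close>.\<close>
  have "lookup a (max i j) < lookup c (max i j)"
    using i j by (cases i j rule: linorder_cases) (auto simp: max_def)
  moreover have "\<forall>k>max i j. lookup a k = lookup c k"
    using i j by simp
  ultimately show ?thesis
    using True by (auto simp: mon_greater_iff)
next
  case False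
  then show ?thesis using assms by (auto simp: mon_greater_iff)
qed

lemma mon_greater_add: "c + b \<succ>\<^sub>m c + a \<longleftrightarrow> b \<succ>\<^sub>m a"
  by (simp add: mon_greater_iff mdeg_add lookup_add)

text \<open>In all variables the order is not well-founded: t_1 > t_2 > t_3 > ... descends forever.
  In the first \<open>s\<close> variables only finitely many exponents lie below a given
  \<open>a\<close>, as their degrees are bounded by that of \<open>a\<close>, and their number is
  the induction measure.\<close>

lemma mon_greater_induct [consumes 1, case_names less]:
  assumes "keys a \<subseteq> {1..s}"
    and step: "\<And>a. keys a \<subseteq> {1..s} \<Longrightarrow> (\<And>b. keys b \<subseteq> {1..s} \<Longrightarrow> a \<succ>\<^sub>m b \<Longrightarrow> Q b) \<Longrightarrow> Q a"
  shows "Q a"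
  using assms(1)
proof (induction "card {b. keys b \<subseteq> {1..s} \<and> a \<succ>\<^sub>m b}" arbitrary: a rule: less_induct)
  case less
  show ?case
  proof (rule step[OF less.prems])
    fix b assume b: "keys b \<subseteq> {1..s}" "a \<succ>\<^sub>m b"
    have "{c. keys c \<subseteq> {1..s} \<and> b \<succ>\<^sub>m c} \<subset> {c. keys c \<subseteq> {1..s} \<and> a \<succ>\<^sub>m c}"
      using b mon_greater_trans mon_greater_irrefl by blast
    moreover have "finite {c. keys c \<subseteq> {1..s} \<and> a \<succ>\<^sub>m c}"
      by (rule finite_subset[OF _ finite_expo_bounded[of "{1..s}" "mdeg a"]])
        (auto simp: mon_greater_iff)
    ultimately show "Q b"
      using less.hyps b psubset_card_mono by blast
  qed
qed

section \<open>Polynomials and leading exponents\<close>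

lemma mem_mpoly_ring_iff: "p \<in> carrier (mpoly_ring m) \<longleftrightarrow> (\<forall>a\<in>keys p. keys a \<subseteq> {1..m})"
  by (simp add: mpoly_ring_def)

lemma mpoly_ring_simps:
  "x \<otimes>\<^bsub>mpoly_ring m\<^esub> y = x * y" "x \<oplus>\<^bsub>mpoly_ring m\<^esub> y = x + y"
  "\<zero>\<^bsub>mpoly_ring m\<^esub> = 0" "\<one>\<^bsub>mpoly_ring m\<^esub> = 1"
  by (simp_all add: mpoly_ring_def)

section \<open>Expansion of a polynomial into its terms\<close>

lemma sum_single_lookup: "(\<Sum>a\<in>keys p. single a (lookup p a)) = p"
  by (rule poly_mapping_eqI) (auto simp: lookup_sum lookup_single when_def in_keys_iff)

lemma mpoly_induct [case_names single add]:
  assumes "\<And>a c. Q (single a c)" and add: "\<And>f g. Q f \<Longrightarrow> Q g \<Longrightarrow> Q (f + g)"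
  shows "Q (f :: 'a \<Rightarrow>\<^sub>0 'b::comm_monoid_add)"
proof -
  have "Q (\<Sum>a\<in>A. single a (lookup f a))" if "finite A" for A
    using that
  proof induction
    case empty
    \<comment> \<open>The zero polynomial is a term with coefficient 0, at whatever
      exponent.\<close>
    show ?case using assms(1)[of undefined 0] by simp
  qed (simp add: assms)
  from this[of "keys f"] show ?thesis by (simp add: sum_single_lookup)
qed

lemma lookup_single_mult: "lookup (single m c * f) (m + a) = c * lookup (f :: 'k::field mpol) a"
  by (induction f rule: mpoly_induct)
    (auto simp: mult_single lookup_single when_def distrib_left lookup_add)

lemma keys_single_mult:
  assumes "c \<noteq> 0"
  shows "keys (single m c * f) = (+) m ` keys (f :: 'k::field mpol)"
proof
  show "keys (single m c * f) \<subseteq> (+) m ` keys f"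
    using keys_mult[of "single m c" f] assms by auto
  show "(+) m ` keys f \<subseteq> keys (single m c * f)"
    using assms by (auto simp: in_keys_iff lookup_single_mult)
qed

text \<open>Injectivity of the relabelling keeps distinct terms from merging, so no coefficients can
  cancel. Homogenization and its inverse are both sums of this shape.\<close>

lemma lookup_sum_single_inj:
  assumes "finite A" "inj_on \<phi> A" "a \<in> A"
  shows "lookup (\<Sum>b\<in>A. single (\<phi> b) (c b)) (\<phi> a) = c a"
proof -
  have "lookup (\<Sum>b\<in>A. single (\<phi> b) (c b)) (\<phi> a) = (\<Sum>b\<in>A. if b = a then c b else 0)"
    unfolding lookup_sum
    using assms by (intro sum.cong) (auto simp: lookup_single when_def inj_on_eq_iff)
  then show ?thesis using assms by simp
qed

lemma keys_sum_subset: "keys (sum h A) \<subseteq> (\<Union>i\<in>A. keys (h i))"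
proof
  fix a assume "a \<in> keys (sum h A)"
  then have "(\<Sum>i\<in>A. lookup (h i) a) \<noteq> 0"
    by (simp add: in_keys_iff lookup_sum)
  then show "a \<in> (\<Union>i\<in>A. keys (h i))"
    by (auto simp: in_keys_iff dest: sum.not_neutral_contains_not_neutral)
qed

lemma keys_sum_single_inj:
  assumes "finite A" "inj_on \<phi> A" "\<And>a. a \<in> A \<Longrightarrow> c a \<noteq> 0"
  shows "keys (\<Sum>b\<in>A. single (\<phi> b) (c b)) = \<phi> ` A"
proof
  show "keys (\<Sum>b\<in>A. single (\<phi> b) (c b)) \<subseteq> \<phi> ` A"
    using keys_sum_subset[of "\<lambda>b. single (\<phi> b) (c b)" A] by (auto split: if_splits)
  show "\<phi> ` A \<subseteq> keys (\<Sum>b\<in>A. single (\<phi> b) (c b))"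
    by (rule image_subsetI)
      (simp add: in_keys_iff assms(3) lookup_sum_single_inj[OF assms(1,2)] del: lookup_not_eq_zero_eq_in_keys)
qed

section \<open>Uniqueness and existence of the leading exponent\<close>

lemma lead_expo_eqI:
  assumes "b \<in> keys f" "\<And>a. a \<in> keys f \<Longrightarrow> a \<noteq> b \<Longrightarrow> b \<succ>\<^sub>m a"
  shows "lead_expo f = b"
  unfolding lead_expo_def
proof (rule the_equality)
  fix c assume "c \<in> keys f \<and> (\<forall>a\<in>keys f. a \<noteq> c \<longrightarrow> c \<succ>\<^sub>m a)"
  then show "c = b"
    using assms mon_greater_trans[of b c b] mon_greater_irrefl[of b] by metis
qed (use assms in blast)

lemma
  assumes "f \<noteq> 0"
  shows lead_expo_in_keys: "lead_expo f \<in> keys f"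
    and lead_expo_greatest: "a \<in> keys f \<Longrightarrow> a \<noteq> lead_expo f \<Longrightarrow> lead_expo f \<succ>\<^sub>m a"
proof -
  have "keys f \<noteq> {}"
    using assms poly_mapping_eqI[of f 0] by (auto simp: in_keys_iff)
  moreover have "transp_on (keys f) (\<lambda>a b. b \<succ>\<^sub>m a)" "totalp_on (keys f) (\<lambda>a b. b \<succ>\<^sub>m a)"
    by (rule transp_onI, erule (1) mon_greater_trans[rotated])
      (rule totalp_onI, use mon_greater_total in blast)
  ultimately obtain b where b: "b \<in> keys f" "\<forall>a\<in>keys f. a \<noteq> b \<longrightarrow> b \<succ>\<^sub>m a"
    using Finite_Set.bex_greatest_element[of "keys f" "\<lambda>a b. b \<succ>\<^sub>m a"] by auto
  then have "lead_expo f = b"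
    by (intro lead_expo_eqI) auto
  with b show "lead_expo f \<in> keys f" "a \<in> keys f \<Longrightarrow> a \<noteq> lead_expo f \<Longrightarrow> lead_expo f \<succ>\<^sub>m a"
    by blast+
qed

lemma mdeg_le_tdeg: "a \<in> keys f \<Longrightarrow> mdeg a \<le> tdeg f"
  unfolding tdeg_def by simp

lemma tdeg_eq_mdeg_lead_expo:
  assumes "f \<noteq> 0"
  shows "tdeg f = mdeg (lead_expo f)"
proof (rule antisym)
  show "mdeg (lead_expo f) \<le> tdeg f"
    by (rule mdeg_le_tdeg[OF lead_expo_in_keys[OF assms]])
  have "mdeg a \<le> mdeg (lead_expo f)" if "a \<in> keys f" for a
    using lead_expo_greatest[OF assms that] by (cases "a = lead_expo f") (auto simp: mon_greater_iff)
  moreover have "keys f \<noteq> {}"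
    using lead_expo_in_keys[OF assms] by blast
  ultimately show "tdeg f \<le> mdeg (lead_expo f)"
    by (simp add: tdeg_def)
qed

section \<open>Ideals\<close>

lemma ring_mpoly_ring: "ring (mpoly_ring m :: 'k::field mpol ring)"
  by (rule cring.axioms(1)[OF cring_mpoly_ring])

text \<open>Closure under multiplication by terms suffices because every polynomial is a finite sum
  of terms; additive inverses come from the constant term -1.\<close>

lemma ideal_mpoly_ringI:
  fixes K :: "'k::field mpol set"
  assumes sub: "K \<subseteq> carrier (mpoly_ring n)" and zero: "0 \<in> K"
    and add: "\<And>p q. p \<in> K \<Longrightarrow> q \<in> K \<Longrightarrow> p + q \<in> K"
    and smult: "\<And>m c p. keys m \<subseteq> {1..n} \<Longrightarrow> p \<in> K \<Longrightarrow> single m c * p \<in> K"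
  shows "ideal K (mpoly_ring n)"
proof -
  interpret cring "mpoly_ring n :: 'k mpol ring" by (rule cring_mpoly_ring)
  have mult: "q * p \<in> K" if "q \<in> carrier (mpoly_ring n)" "p \<in> K" for p q
  proof -
    have "(\<Sum>a\<in>A. single a (lookup q a)) * p \<in> K" if "finite A" "A \<subseteq> keys q" for A
      using that
    proof induction
      case (insert a A)
      then have "single a (lookup q a) * p \<in> K"
        using \<open>q \<in> carrier _\<close> \<open>p \<in> K\<close> by (intro smult) (auto simp: mem_mpoly_ring_iff)
      then show ?case using insert by (simp add: distrib_right add)
    qed (simp add: zero)
    from this[of "keys q"] show ?thesis by (simp add: sum_single_lookup)
  qed
  show ?thesis
  proof (rule idealI)
    show "subgroup K (add_monoid (mpoly_ring n))"
    proof (rule subgroup.intro)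
      fix p assume "p \<in> K"
      then have "single 0 (-1) * p \<in> K" by (intro smult) simp
      then have "- p \<in> K" by (simp add: single_uminus)
      then have "\<ominus>\<^bsub>mpoly_ring n\<^esub> p = - p"
        using \<open>p \<in> K\<close> sub by (intro minus_equality) (auto simp: mpoly_ring_simps)
      then show "inv\<^bsub>add_monoid (mpoly_ring n)\<^esub> p \<in> K"
        using \<open>- p \<in> K\<close> by (simp add: a_inv_def)
    qed (use sub zero add in \<open>auto simp: mpoly_ring_simps\<close>)
    show "a \<otimes>\<^bsub>mpoly_ring n\<^esub> x \<in> K" if "a \<in> K" "x \<in> carrier (mpoly_ring n)" for a x
      using mult[OF that(2,1)] by (simp add: mpoly_ring_simps mult.commute)
  qed (use mult in \<open>auto simp: mpoly_ring_simps ring_mpoly_ring\<close>)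
qed

lemma
  fixes I :: "'k::field mpol set"
  assumes "ideal I (mpoly_ring n)"
  shows ideal_mpoly_add: "p \<in> I \<Longrightarrow> q \<in> I \<Longrightarrow> p + q \<in> I"
    and ideal_mpoly_term: "keys m \<subseteq> {1..n} \<Longrightarrow> p \<in> I \<Longrightarrow> single m c * p \<in> I"
    and ideal_mpoly_zero: "0 \<in> I"
    and ideal_mpoly_sub: "I \<subseteq> carrier (mpoly_ring n)"
    and ideal_mpoly_diff: "p \<in> I \<Longrightarrow> q \<in> I \<Longrightarrow> p - q \<in> I"
proof -
  interpret ideal I "mpoly_ring n" by fact
  show add: "p \<in> I \<Longrightarrow> q \<in> I \<Longrightarrow> p + q \<in> I" for p q
    using additive_subgroup.a_closed[OF additive_subgroup_axioms, of p q] by (simp add: mpoly_ring_simps)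
  have mult: "q \<in> carrier (mpoly_ring n) \<Longrightarrow> p \<in> I \<Longrightarrow> q * p \<in> I" for p q
    using I_l_closed[of p q] by (simp add: mpoly_ring_simps)
  show trm: "keys m \<subseteq> {1..n} \<Longrightarrow> p \<in> I \<Longrightarrow> single m c * p \<in> I" for m c p
    by (rule mult) (auto simp: mem_mpoly_ring_iff)
  show "0 \<in> I"
    using additive_subgroup.zero_closed[OF additive_subgroup_axioms] by (simp add: mpoly_ring_simps)
  show "I \<subseteq> carrier (mpoly_ring n)"
    by (rule a_subset)
  show "p - q \<in> I" if "p \<in> I" "q \<in> I"
    using add[OF that(1) trm[OF _ that(2), of 0 "-1"]] by (simp add: single_uminus)
qed

text \<open>The polynomials all of whose monomials are divisible by some generator form an ideal
  \<open>K\<close> containing the generators, hence containing the monomial ideal.\<close>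

lemma keys_Idl_monomials:
  fixes A :: "'k::field mpol set"
  assumes A: "lead_monom ` A \<subseteq> carrier (mpoly_ring n)"
    and p: "p \<in> Idl\<^bsub>mpoly_ring n\<^esub> (lead_monom ` A)" and a: "a \<in> keys p"
  shows "\<exists>g\<in>A. \<exists>m. a = m + lead_expo g"
proof -
  interpret ring "mpoly_ring n :: 'k mpol ring" by (rule ring_mpoly_ring)
  define K where "K = {q \<in> carrier (mpoly_ring n :: 'k mpol ring).
    \<forall>a\<in>keys q. \<exists>g\<in>A. \<exists>m. a = m + lead_expo g}"
  have "ideal K (mpoly_ring n)"
  proof (rule ideal_mpoly_ringI)
    fix q r assume "q \<in> K" "r \<in> K"
    then show "q + r \<in> K"
      using Poly_Mapping.keys_add[of q r] by (fastforce simp: K_def mem_mpoly_ring_iff)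
  next
    fix m :: expo and c :: 'k and q assume *: "keys m \<subseteq> {1..n}" "q \<in> K"
    have "\<exists>g\<in>A. \<exists>m'. m + b = m' + lead_expo g" if b: "b \<in> keys q" for b
    proof -
      obtain g m' where "g \<in> A" "b = m' + lead_expo g"
        using *(2) b by (auto simp: K_def)
      then have "m + b = (m + m') + lead_expo g"
        by (simp add: add.assoc)
      with \<open>g \<in> A\<close> show ?thesis by blast
    qed
    then show "single m c * q \<in> K"
      using * by (cases "c = 0") (simp_all add: K_def mem_mpoly_ring_iff keys_single_mult keys_add_expo)
  qed (auto simp: K_def mem_mpoly_ring_iff)
  moreover have "lead_monom ` A \<subseteq> K"
  proof (rule image_subsetI)
    fix g assume g: "g \<in> A"
    have "lead_expo g = 0 + lead_expo g" by simp
    with g have "\<exists>h\<in>A. \<exists>m. lead_expo g = m + lead_expo h" by blast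
    moreover have "lead_monom g \<in> carrier (mpoly_ring n)"
      using g A by blast
    moreover have "keys (lead_monom g) = {lead_expo g}"
      by (simp add: lead_monom_def)
    ultimately show "lead_monom g \<in> K"
      by (simp only: K_def mem_Collect_eq ball_simps simp_thms)
  qed
  ultimately have "p \<in> K"
    using genideal_minimal p by blast
  with a show ?thesis by (simp add: K_def)
qed

lemma lead_monom_carrier:
  assumes "A \<subseteq> carrier (mpoly_ring n)"
  shows "lead_monom ` (A - {0}) \<subseteq> carrier (mpoly_ring n)"
  using assms lead_expo_in_keys by (fastforce simp: lead_monom_def mem_mpoly_ring_iff)

text \<open>Turns equality of initial ideals into divisibility: \<open>lead_monom f\<close> lies in
  a monomial ideal and has \<open>lead_expo f\<close> as its only exponent.\<close>

lemma groebner_basis_lead_expo: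
  assumes "groebner_basis n I G" "f \<in> I" "f \<noteq> 0"
  obtains g m where "g \<in> G" "g \<noteq> 0" "lead_expo f = m + lead_expo g"
proof -
  interpret ring "mpoly_ring n :: 'a mpol ring" by (rule ring_mpoly_ring)
  from assms have I: "I \<subseteq> carrier (mpoly_ring n)" and G: "G \<subseteq> I"
    and eq: "initial_ideal n G = initial_ideal n I"
    by (auto simp: groebner_basis_def dest: ideal_mpoly_sub)
  have "lead_monom f \<in> initial_ideal n I"
    unfolding initial_ideal_def
    using assms genideal_self[OF lead_monom_carrier[OF I]] by blast
  then have "lead_monom f \<in> Idl\<^bsub>mpoly_ring n\<^esub> (lead_monom ` (G - {0}))"
    by (simp only: eq[symmetric] initial_ideal_def[of n G])
  then have "\<exists>g\<in>G - {0}. \<exists>m. lead_expo f = m + lead_expo g"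
    using I G by (intro keys_Idl_monomials[of "G - {0}" n "lead_monom f"] lead_monom_carrier)
      (auto simp: lead_monom_def)
  then show ?thesis using that by blast
qed

section \<open>Homogenization and dehomogenization\<close>

definition homog_expo :: "nat \<Rightarrow> nat \<Rightarrow> expo \<Rightarrow> expo" where
  "homog_expo s e a = a + single (Suc s) (e - mdeg a)"

definition dehom_expo :: "nat \<Rightarrow> expo \<Rightarrow> expo" where
  "dehom_expo s a = a - single (Suc s) (lookup a (Suc s))"

text \<open>The target degree \<open>e\<close> is a parameter of its own because homogenization is
  additive only when the degree does not vary with the polynomial.\<close>

definition homog :: "nat \<Rightarrow> nat \<Rightarrow> 'k::field mpol \<Rightarrow> 'k mpol" where
  "homog s e f = (\<Sum>a\<in>keys f. single (homog_expo s e a) (lookup f a))"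

text \<open>The value at \<open>u = 1\<close> of the homogeneous component of degree \<open>d\<close>.\<close>

definition dehom :: "nat \<Rightarrow> nat \<Rightarrow> 'k::field mpol \<Rightarrow> 'k mpol" where
  "dehom s d F = (\<Sum>a\<in>keys F. if mdeg a = d then single (dehom_expo s a) (lookup F a) else 0)"

lemma homogenize_eq_homog: "homogenize s f = homog s (tdeg f) f"
  by (simp add: homogenize_def homog_def homog_expo_def)

lemma homog_zero [simp]: "homog s e 0 = 0"
  by (simp add: homog_def)

lemma homog_single: "homog s e (single a c) = single (homog_expo s e a) c"
  by (simp add: homog_def)

lemma homog_add: "homog s e (f + g) = homog s e f + homog s e g"
  unfolding homog_def by (rule setsum_keys_plus_distrib) (auto simp: single_add)

lemma homog_sum: "homog s e (sum h A) = (\<Sum>i\<in>A. homog s e (h i))"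
  by (induction A rule: infinite_finite_induct) (auto simp: homog_add)

lemma dehom_zero [simp]: "dehom s d 0 = 0"
  by (simp add: dehom_def)

lemma dehom_single: "dehom s d (single a c) = (if mdeg a = d then single (dehom_expo s a) c else 0)"
  by (simp add: dehom_def)

lemma dehom_add: "dehom s d (f + g) = dehom s d f + dehom s d g"
  unfolding dehom_def
  by (rule setsum_keys_plus_distrib[where f = "\<lambda>a c. if mdeg a = d then single (dehom_expo s a) c else 0"])
    (auto simp: single_add)

lemma dehom_sum: "dehom s d (sum h A) = (\<Sum>i\<in>A. dehom s d (h i))"
  by (induction A rule: infinite_finite_induct) (auto simp: dehom_add)

section \<open>Exponents, degrees and supports under both passages\<close>

lemma dehom_expo_add: "dehom_expo s (a + b) = dehom_expo s a + dehom_expo s b"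
  by (rule poly_mapping_eqI) (auto simp: dehom_expo_def lookup_add lookup_minus lookup_single when_def)

lemma dehom_expo_split: "dehom_expo s a + single (Suc s) (lookup a (Suc s)) = a"
  by (rule poly_mapping_eqI) (auto simp: dehom_expo_def lookup_add lookup_minus lookup_single when_def)

lemma mdeg_dehom_expo: "mdeg (dehom_expo s a) + lookup a (Suc s) = mdeg a"
  by (metis dehom_expo_split mdeg_add mdeg_single)

lemma lookup_dehom_expo: "lookup (dehom_expo s a) i = (if i = Suc s then 0 else lookup a i)"
  by (auto simp: dehom_expo_def lookup_minus lookup_single when_def)

text \<open>The total degree remembers the power of \<open>u\<close> that dehomogenization
  drops.\<close>

lemma homog_dehom_expo: "homog_expo s (mdeg a) (dehom_expo s a) = a"
proof -
  have "mdeg a - mdeg (dehom_expo s a) = lookup a (Suc s)"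
    by (simp flip: mdeg_dehom_expo[of s a])
  then show ?thesis by (simp add: homog_expo_def dehom_expo_split)
qed

lemma dehom_homog_expo:
  assumes "keys a \<subseteq> {1..s}"
  shows "dehom_expo s (homog_expo s e a) = a"
proof -
  have "Suc s \<notin> keys a" using assms by auto
  then show ?thesis
    by (intro poly_mapping_eqI)
      (auto simp: lookup_dehom_expo homog_expo_def lookup_add lookup_single when_def in_keys_iff)
qed

lemma mdeg_homog_expo: "mdeg a \<le> e \<Longrightarrow> mdeg (homog_expo s e a) = e"
  by (simp add: homog_expo_def mdeg_add mdeg_single)

lemma keys_dehom_expo: "keys a \<subseteq> {1..Suc s} \<Longrightarrow> keys (dehom_expo s a) \<subseteq> {1..s}"
proof
  fix i assume a: "keys a \<subseteq> {1..Suc s}" and "i \<in> keys (dehom_expo s a)"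
  then have "i \<noteq> Suc s" "i \<in> keys a"
    by (auto simp: in_keys_iff lookup_dehom_expo split: if_splits)
  then show "i \<in> {1..s}" using subsetD[OF a] by force
qed

lemma keys_homog_expo: "keys a \<subseteq> {1..s} \<Longrightarrow> keys (homog_expo s e a) \<subseteq> {1..Suc s}"
  unfolding homog_expo_def keys_add_expo by (auto dest: subsetD split: if_splits)

lemma homog_carrier:
  assumes "f \<in> carrier (mpoly_ring s)"
  shows "homog s e f \<in> carrier (mpoly_ring (Suc s))"
proof -
  have "keys (homog s e f) \<subseteq> homog_expo s e ` keys f"
    unfolding homog_def
    using keys_sum_subset[of "\<lambda>a. single (homog_expo s e a) (lookup f a)" "keys f"]
    by (auto split: if_splits)
  moreover have "keys (homog_expo s e a) \<subseteq> {1..Suc s}" if "a \<in> keys f" for a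
    using assms that by (intro keys_homog_expo) (simp add: mem_mpoly_ring_iff)
  ultimately show ?thesis
    unfolding mem_mpoly_ring_iff by blast
qed

lemma dehom_eq:
  "dehom s d F = (\<Sum>a\<in>{a \<in> keys F. mdeg a = d}. single (dehom_expo s a) (lookup F a))"
  unfolding dehom_def by (simp add: sum.inter_filter)

text \<open>On exponents of one fixed degree \<open>d\<close>, \<open>homog_expo s d\<close> is a
  left inverse.\<close>

lemma inj_on_dehom_expo: "inj_on (dehom_expo s) {a \<in> A. mdeg a = d}"
  by (rule inj_onI) (metis (mono_tags, lifting) homog_dehom_expo mem_Collect_eq)

lemma keys_dehom: "keys (dehom s d F) = dehom_expo s ` {a \<in> keys F. mdeg a = d}"
  unfolding dehom_eq by (intro keys_sum_single_inj inj_on_dehom_expo) (auto simp: in_keys_iff)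

lemma dehom_carrier:
  assumes "F \<in> carrier (mpoly_ring (Suc s))"
  shows "dehom s d F \<in> carrier (mpoly_ring s)"
  using assms keys_dehom_expo unfolding mem_mpoly_ring_iff keys_dehom by blast

text \<open>Multiplication by \<open>m\<close> shifts the grading by \<open>mdeg m\<close>, so the
  component of degree \<open>d\<close> comes from the one of degree \<open>d - mdeg m\<close>; below
  \<open>mdeg m\<close> there is nothing.\<close>

lemma dehom_term_mult:
  "dehom s d (single m c * F) =
     (if mdeg m \<le> d then single (dehom_expo s m) c * dehom s (d - mdeg m) F else 0)"
  by (induction F rule: mpoly_induct)
    (auto simp: mult_single dehom_single mdeg_add dehom_expo_add distrib_left dehom_add)

text \<open>Truncation is harmless here, since truncated subtraction satisfies \<open>e - (i + j) = (e - i) - j\<close>.\<close>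

lemma homog_term_mult: "homog s e (single m c * f) = single m c * homog s (e - mdeg m) f"
  by (induction f rule: mpoly_induct)
    (auto simp: mult_single homog_single homog_expo_def mdeg_add add.assoc distrib_left homog_add)

text \<open>Each missing degree is made up by one further factor \<open>u\<close>, the same for all
  terms. This is the source of the power of \<open>u\<close> in F = u^k g^h.\<close>

lemma homog_raise_degree:
  assumes "tdeg f \<le> e"
  shows "homog s e f = single (single (Suc s) (e - tdeg f)) 1 * homogenize s f"
proof -
  have "homog_expo s e a = single (Suc s) (e - tdeg f) + homog_expo s (tdeg f) a" if "a \<in> keys f" for a
    using mdeg_le_tdeg[OF that] assms
    by (simp add: homog_expo_def add.left_commute flip: single_add)
  then show ?thesis
    by (simp add: homogenize_eq_homog homog_def sum_distrib_left mult_single)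
qed

lemma homog_dehom:
  assumes "\<forall>a\<in>keys F. mdeg a = d"
  shows "homog s d (dehom s d F) = F"
proof -
  have "homog s d (dehom s d F) = (\<Sum>a\<in>keys F. single a (lookup F a))"
    unfolding dehom_def homog_sum
    using assms homog_dehom_expo[of s] by (intro sum.cong) (auto simp: homog_single)
  then show ?thesis by (simp add: sum_single_lookup)
qed

lemma dehom_homog:
  assumes "f \<in> carrier (mpoly_ring s)" "tdeg f \<le> e"
  shows "dehom s d (homog s e f) = (if d = e then f else 0)"
proof -
  have "dehom s d (homog s e f) = (\<Sum>a\<in>keys f. if d = e then single a (lookup f a) else 0)"
    unfolding homog_def dehom_sum
    using assms mdeg_le_tdeg
    by (intro sum.cong) (fastforce simp: dehom_single mdeg_homog_expo dehom_homog_expo mem_mpoly_ring_iff)+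
  then show ?thesis by (simp add: sum_single_lookup)
qed

lemma keys_homog:
  assumes "f \<in> carrier (mpoly_ring s)"
  shows "keys (homog s e f) = homog_expo s e ` keys f"
proof -
  have "inj_on (homog_expo s e) (keys f)"
    using assms dehom_homog_expo by (intro inj_on_inverseI[where g = "dehom_expo s"])
      (auto simp: mem_mpoly_ring_iff)
  then show ?thesis
    unfolding homog_def by (intro keys_sum_single_inj) (auto simp: in_keys_iff)
qed

lemma homogenize_eq_0_iff:
  assumes "f \<in> carrier (mpoly_ring s)"
  shows "homogenize s f = 0 \<longleftrightarrow> f = 0"
  using dehom_homog[OF assms order_refl, of "tdeg f"] by (auto simp: homogenize_eq_homog)

text \<open>
  Since \<open>u\<close> is the smallest variable in a reverse lexicographic order, the terms of \<open>f\<^sup>h\<close> that come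
  from the top degree part of \<open>f\<close> are the largest ones.
\<close>

lemma lead_expo_homogenize:
  assumes f: "f \<in> carrier (mpoly_ring s)" "f \<noteq> 0"
  shows "lead_expo (homogenize s f) = lead_expo f"
proof (rule lead_expo_eqI)
  let ?b = "lead_expo f"
  have b: "?b \<in> keys f" "homog_expo s (tdeg f) ?b = ?b"
    using f lead_expo_in_keys by (auto simp: homog_expo_def tdeg_eq_mdeg_lead_expo)
  then show "?b \<in> keys (homogenize s f)"
    using f by (force simp: homogenize_eq_homog keys_homog)
  fix a' assume "a' \<in> keys (homogenize s f)" "a' \<noteq> ?b"
  then obtain a where a: "a \<in> keys f" "a' = homog_expo s (tdeg f) a"
    using f by (auto simp: homogenize_eq_homog keys_homog)
  show "?b \<succ>\<^sub>m a'"
  proof (cases "mdeg a = tdeg f")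
    case True
    then have "a' = a" by (simp add: a homog_expo_def)
    then show ?thesis
      using a \<open>a' \<noteq> ?b\<close> f lead_expo_greatest by blast
  next
    case False
    then have lt: "mdeg a < tdeg f"
      using mdeg_le_tdeg[OF a(1)] by simp
    have out: "lookup c j = 0" if "c \<in> keys f" "j > s" for c j
      using f that by (force simp: mem_mpoly_ring_iff in_keys_iff)
    \<comment> \<open>After homogenization both exponents have degree \<open>tdeg f\<close>, and
      \<open>u\<close> is the last variable in which they differ: it occurs in \<open>a'\<close> but
      not in \<open>?b\<close>.\<close>
    have "lookup ?b (Suc s) < lookup a' (Suc s)"
      using lt out[OF b(1)] by (simp add: a homog_expo_def lookup_add)
    moreover have "lookup ?b j = lookup a' j" if "j > Suc s" for j
      using that out[OF b(1)] out[OF a(1)] by (simp add: a homog_expo_def lookup_add lookup_single)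
    moreover have "mdeg a' = mdeg ?b"
      using lt f by (simp add: a mdeg_homog_expo tdeg_eq_mdeg_lead_expo)
    ultimately show ?thesis
      by (auto simp: mon_greater_iff)
  qed
qed

text \<open>If the comparison is decided at \<open>u\<close>, the greater exponent has less
  \<open>u\<close> and so keeps the higher degree. Otherwise both lose the same power of
  \<open>u\<close>, and the same variable still decides.\<close>

lemma dehom_expo_mono:
  assumes "a \<succ>\<^sub>m b" "mdeg a = mdeg b" "keys a \<subseteq> {1..Suc s}" "keys b \<subseteq> {1..Suc s}"
  shows "dehom_expo s a \<succ>\<^sub>m dehom_expo s b"
proof -
  obtain i where i: "lookup a i < lookup b i" "\<forall>j>i. lookup a j = lookup b j"
    using assms by (auto simp: mon_greater_iff)
  then have "i \<in> keys b" by (auto simp: in_keys_iff)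
  then have "i \<le> Suc s" using assms by auto
  show ?thesis
  proof (cases "i = Suc s")
    case True
    then show ?thesis
      using i assms(2) mdeg_dehom_expo[of s a] mdeg_dehom_expo[of s b] by (simp add: mon_greater_iff)
  next
    case False
    then have "lookup a (Suc s) = lookup b (Suc s)"
      using i \<open>i \<le> Suc s\<close> by simp
    then have "mdeg (dehom_expo s a) = mdeg (dehom_expo s b)"
      using assms(2) mdeg_dehom_expo[of s a] mdeg_dehom_expo[of s b] by simp
    then show ?thesis
      using i False by (auto simp: mon_greater_iff lookup_dehom_expo)
  qed
qed

text \<open>The nonzero component of \<open>F\<close> that matters is the one containing its leading
  exponent; within one degree, setting u = 1 preserves the order.\<close>

lemma lead_expo_dehom:
  assumes F: "F \<in> carrier (mpoly_ring (Suc s))" "F \<noteq> 0"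
  shows "dehom s (mdeg (lead_expo F)) F \<noteq> 0"
    and "lead_expo (dehom s (mdeg (lead_expo F)) F) = dehom_expo s (lead_expo F)"
proof -
  let ?b = "lead_expo F"
  have b: "?b \<in> keys F" using F lead_expo_in_keys by blast
  then have mem: "dehom_expo s ?b \<in> keys (dehom s (mdeg ?b) F)"
    by (simp add: keys_dehom)
  then show "dehom s (mdeg ?b) F \<noteq> 0" by auto
  from mem show "lead_expo (dehom s (mdeg ?b) F) = dehom_expo s ?b"
  proof (rule lead_expo_eqI)
    fix a' assume "a' \<in> keys (dehom s (mdeg ?b) F)" "a' \<noteq> dehom_expo s ?b"
    then obtain a where "a \<in> keys F" "mdeg a = mdeg ?b" "a' = dehom_expo s a" "a \<noteq> ?b"
      by (auto simp: keys_dehom)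
    then show "dehom_expo s ?b \<succ>\<^sub>m a'"
      using F b lead_expo_greatest[OF F(2)] dehom_expo_mono[of ?b a s]
      by (simp add: mem_mpoly_ring_iff)
  qed
qed

section \<open>Groebner bases and homogenization\<close>

lemma Idl_homogenize_dehom:
  fixes I :: "'k::field mpol set"
  assumes I: "ideal I (mpoly_ring s)" and G: "G \<subseteq> I"
    and F: "F \<in> Idl\<^bsub>mpoly_ring (Suc s)\<^esub> (homogenize s ` G)"
  shows "dehom s d F \<in> I"
proof -
  interpret ring "mpoly_ring (Suc s) :: 'k mpol ring" by (rule ring_mpoly_ring)
  \<comment> \<open>All degrees are required at once, since multiplication by a term moves one
    component to another degree.\<close>
  define K where "K = {F \<in> carrier (mpoly_ring (Suc s) :: 'k mpol ring). \<forall>d. dehom s d F \<in> I}"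
  have "ideal K (mpoly_ring (Suc s))"
  proof (rule ideal_mpoly_ringI)
    fix p q assume "p \<in> K" "q \<in> K"
    then show "p + q \<in> K"
      using a_closed[of p q]
      by (simp add: K_def mpoly_ring_simps dehom_add ideal_mpoly_add[OF I])
  next
    fix m :: expo and c :: 'k and p assume m: "keys m \<subseteq> {1..Suc s}" and p: "p \<in> K"
    have "single m c \<in> carrier (mpoly_ring (Suc s))"
      using m by (simp add: mem_mpoly_ring_iff)
    then have "single m c * p \<in> carrier (mpoly_ring (Suc s))"
      using p m_closed[of "single m c" p] by (simp add: K_def mpoly_ring_simps)
    then show "single m c * p \<in> K"
      using p keys_dehom_expo[OF m]
      by (simp add: K_def dehom_term_mult ideal_mpoly_term[OF I] ideal_mpoly_zero[OF I])
  qed (auto simp: K_def mem_mpoly_ring_iff ideal_mpoly_zero[OF I])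
  moreover have "homogenize s ` G \<subseteq> K"
    using G ideal_mpoly_sub[OF I] ideal_mpoly_zero[OF I]
    by (auto simp: K_def homogenize_eq_homog homog_carrier dehom_homog subset_iff)
  ultimately have "F \<in> K"
    using genideal_minimal F by blast
  then show ?thesis by (simp add: K_def)
qed

lemma homogenize_carrier:
  "f \<in> carrier (mpoly_ring s) \<Longrightarrow> homogenize s f \<in> carrier (mpoly_ring (Suc s))"
  by (simp add: homogenize_eq_homog homog_carrier)

text \<open>One division step per induction step: a multiple \<open>h\<close> of a basis element
  cancels the leading term of \<open>f\<close>, and \<open>f = h + (f - h)\<close> is homogenized to
  the degree of \<open>f\<close>, where homogenization is additive.\<close>

lemma homogenize_in_Idl:
  fixes I :: "'k::field mpol set"
  assumes GB: "groebner_basis s I G" and f: "f \<in> I"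
  shows "homogenize s f \<in> Idl\<^bsub>mpoly_ring (Suc s)\<^esub> (homogenize s ` G)" (is "_ \<in> ?J")
proof -
  interpret ring "mpoly_ring (Suc s) :: 'k mpol ring" by (rule ring_mpoly_ring)
  have I: "ideal I (mpoly_ring s)" and G: "G \<subseteq> I"
    using GB by (auto simp: groebner_basis_def)
  note sub = ideal_mpoly_sub[OF I]
  have Gh: "homogenize s ` G \<subseteq> carrier (mpoly_ring (Suc s))"
    using G sub homogenize_carrier by blast
  have J: "ideal ?J (mpoly_ring (Suc s))"
    using Gh by (rule genideal_ideal)
  have *: "f \<noteq> 0 \<longrightarrow> lead_expo f = a \<longrightarrow> homogenize s f \<in> ?J"
    if "keys a \<subseteq> {1..s}" "f \<in> I" for a f
    using that
  proof (induction a arbitrary: f rule: mon_greater_induct)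
    case (less a)
    show ?case
    proof (intro impI)
      assume f0: "f \<noteq> 0" and a: "lead_expo f = a"
      obtain g m where g: "g \<in> G" "g \<noteq> 0" and m: "a = m + lead_expo g"
        using groebner_basis_lead_expo[OF GB less.prems f0] a by metis
      \<comment> \<open>The quotient of the leading coefficients, so that \<open>h\<close> has the
        same coefficient at \<open>a\<close> as \<open>f\<close>.\<close>
      define c where "c = lookup f a / lookup g (lead_expo g)"
      define h where "h = single m c * g"
      have "lookup f a \<noteq> 0" "lookup g (lead_expo g) \<noteq> 0"
        using lead_expo_in_keys[OF f0] lead_expo_in_keys[OF g(2)] a by (auto simp: in_keys_iff)
      then have c: "c \<noteq> 0" and h_a: "lookup h a = lookup f a"
        by (auto simp: c_def h_def m lookup_single_mult)
      have km: "keys m \<subseteq> {1..s}"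
        using less.hyps by (simp add: m keys_add_expo)
      have hI: "h \<in> I"
        unfolding h_def by (rule ideal_mpoly_term[OF I km]) (use g G in blast)
      have below: "a \<succ>\<^sub>m b" if "b \<in> keys (f - h)" for b
      proof -
        have "b \<noteq> a" using that h_a by (auto simp: in_keys_iff lookup_minus)
        have "b \<in> keys f \<or> b \<in> keys h" using that by (auto simp: in_keys_iff lookup_minus)
        then show ?thesis
        proof
          assume "b \<in> keys f"
          then show ?thesis using \<open>b \<noteq> a\<close> a lead_expo_greatest[OF f0] by blast
        next
          assume "b \<in> keys h"
          then obtain b' where "b' \<in> keys g" "b = m + b'"
            using c by (auto simp: h_def keys_single_mult)
          then show ?thesis
            using \<open>b \<noteq> a\<close> lead_expo_greatest[OF g(2), of b'] by (auto simp: m mon_greater_add)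
        qed
      qed
      \<comment> \<open>The degrees match exactly, so homogenizing \<open>h\<close> to degree
        \<open>tdeg f\<close> introduces no extra power of \<open>u\<close>.\<close>
      have e: "tdeg f = mdeg m + tdeg g"
        using f0 g a by (simp add: tdeg_eq_mdeg_lead_expo m mdeg_add)
      have "homogenize s f = homog s (tdeg f) h + homog s (tdeg f) (f - h)"
        by (simp add: homogenize_eq_homog flip: homog_add)
      moreover have "homog s (tdeg f) h = single m c * homogenize s g"
        by (simp add: h_def homog_term_mult e homogenize_eq_homog)
      moreover have "single m c * homogenize s g \<in> ?J"
        using km g genideal_self[OF Gh] by (intro ideal_mpoly_term[OF J]) auto
      \<comment> \<open>The remainder may have smaller degree than \<open>f\<close>; its part is
        then a power of \<open>u\<close> times its own homogenization, which the induction
        hypothesis covers.\<close>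
      moreover have "homog s (tdeg f) (f - h) \<in> ?J"
      proof (cases "f - h = 0")
        case True
        show ?thesis unfolding True using ideal_mpoly_zero[OF J] by simp
      next
        case False
        let ?b = "lead_expo (f - h)"
        have b: "?b \<in> keys (f - h)" using lead_expo_in_keys[OF False] .
        have fh: "f - h \<in> I" using ideal_mpoly_diff[OF I less.prems hI] .
        have "keys ?b \<subseteq> {1..s}"
          using b fh sub unfolding mem_mpoly_ring_iff subset_iff[of I] by blast
        then have "homogenize s (f - h) \<in> ?J"
          using less.IH[OF _ below[OF b] fh] False by blast
        moreover have "tdeg (f - h) \<le> tdeg f"
          using below[OF b] False f0 a by (auto simp: tdeg_eq_mdeg_lead_expo mon_greater_iff)
        ultimately show ?thesis
          unfolding homog_raise_degree[OF \<open>tdeg (f - h) \<le> tdeg f\<close>]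
          by (intro ideal_mpoly_term[OF J]) auto
      qed
      ultimately show "homogenize s f \<in> ?J"
        by (simp add: ideal_mpoly_add[OF J])
    qed
  qed
  show ?thesis
  proof (cases "f = 0")
    case True
    then show ?thesis using ideal_mpoly_zero[OF J] by (simp add: homogenize_eq_homog)
  next
    case False
    then have "keys (lead_expo f) \<subseteq> {1..s}"
      using f sub lead_expo_in_keys unfolding mem_mpoly_ring_iff subset_iff[of I] by blast
    then show ?thesis using * f False by blast
  qed
qed

lemma homogenize_ideal_eq_Idl:
  fixes I :: "'k::field mpol set"
  assumes GB: "groebner_basis s I G"
  shows "homogenize_ideal s I = Idl\<^bsub>mpoly_ring (Suc s)\<^esub> (homogenize s ` G)"
proof -
  interpret ring "mpoly_ring (Suc s) :: 'k mpol ring" by (rule ring_mpoly_ring)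
  have G: "G \<subseteq> I" and "I \<subseteq> carrier (mpoly_ring s)"
    using GB ideal_mpoly_sub by (auto simp: groebner_basis_def)
  then have Ih: "homogenize s ` I \<subseteq> carrier (mpoly_ring (Suc s))"
    using homogenize_carrier by blast
  then have Gh: "homogenize s ` G \<subseteq> carrier (mpoly_ring (Suc s))"
    using G by blast
  show ?thesis
    unfolding homogenize_ideal_def
  proof
    show "Idl\<^bsub>mpoly_ring (Suc s)\<^esub> (homogenize s ` I) \<subseteq> Idl\<^bsub>mpoly_ring (Suc s)\<^esub> (homogenize s ` G)"
      using genideal_ideal[OF Gh] homogenize_in_Idl[OF GB] by (intro genideal_minimal) auto
    show "Idl\<^bsub>mpoly_ring (Suc s)\<^esub> (homogenize s ` G) \<subseteq> Idl\<^bsub>mpoly_ring (Suc s)\<^esub> (homogenize s ` I)"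
      using G by (intro subset_Idl_subset[OF Ih]) auto
  qed
qed

lemma groebner_basis_homogenize:
  fixes I :: "'k::field mpol set"
  assumes GB: "groebner_basis s I G"
  shows "groebner_basis (Suc s) (Idl\<^bsub>mpoly_ring (Suc s)\<^esub> (homogenize s ` G)) (homogenize s ` G)"
    (is "groebner_basis _ ?J ?H")
proof -
  interpret ring "mpoly_ring (Suc s) :: 'k mpol ring" by (rule ring_mpoly_ring)
  have I: "ideal I (mpoly_ring s)" and G: "G \<subseteq> I" "finite G"
    using GB by (auto simp: groebner_basis_def)
  note sub = ideal_mpoly_sub[OF I]
  have H: "?H \<subseteq> carrier (mpoly_ring (Suc s))"
    using G sub homogenize_carrier by blast
  have J: "ideal ?J (mpoly_ring (Suc s))" and HJ: "?H \<subseteq> ?J"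
    using genideal_ideal[OF H] genideal_self[OF H] by auto
  have Jc: "?J \<subseteq> carrier (mpoly_ring (Suc s))"
    by (rule ideal_mpoly_sub[OF J])
  let ?L = "initial_ideal (Suc s) ?H"
  have L: "ideal ?L (mpoly_ring (Suc s))"
    unfolding initial_ideal_def by (intro genideal_ideal lead_monom_carrier H)
  have "lead_monom F \<in> ?L" if F: "F \<in> ?J" "F \<noteq> 0" for F
  proof -
    \<comment> \<open>\<open>F\<close> may be inhomogeneous, so only its component of the leading
      degree is dehomogenized.\<close>
    let ?a = "lead_expo F" and ?D = "dehom s (mdeg (lead_expo F)) F"
    have Fc: "F \<in> carrier (mpoly_ring (Suc s))"
      using F Jc by blast
    have D: "?D \<in> I" "?D \<noteq> 0" "lead_expo ?D = dehom_expo s ?a"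
      using Idl_homogenize_dehom[OF I G(1) F(1)] lead_expo_dehom[OF Fc F(2)] by auto
    obtain g m where g: "g \<in> G" "g \<noteq> 0" and m: "lead_expo ?D = m + lead_expo g"
      using groebner_basis_lead_expo[OF GB D(1,2)] .
    have gc: "g \<in> carrier (mpoly_ring s)"
      using g G sub by blast
    \<comment> \<open>The cofactor \<open>m\<close> takes back the power of \<open>u\<close> lost on
      setting u = 1.\<close>
    define m' where "m' = m + single (Suc s) (lookup ?a (Suc s))"
    have a: "?a = m' + lead_expo (homogenize s g)"
    proof -
      have "?a = (m + lead_expo g) + single (Suc s) (lookup ?a (Suc s))"
        using dehom_expo_split[of s ?a] D(3) m by metis
      then show ?thesis
        using gc g by (simp add: lead_expo_homogenize m'_def ac_simps)
    qed
    have "keys ?a \<subseteq> {1..Suc s}"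
      using Fc lead_expo_in_keys[OF F(2)] by (auto simp: mem_mpoly_ring_iff)
    then have m': "keys m' \<subseteq> {1..Suc s}"
      by (simp add: a keys_add_expo)
    have "lead_monom (homogenize s g) \<in> ?L"
      unfolding initial_ideal_def
      using genideal_self[OF lead_monom_carrier[OF H]] g gc by (auto simp: homogenize_eq_0_iff)
    from ideal_mpoly_term[OF L m' this, of 1] show ?thesis
      by (simp add: lead_monom_def mult_single flip: a)
  qed
  then have "initial_ideal (Suc s) ?J \<subseteq> ?L"
    unfolding initial_ideal_def[of "Suc s" ?J] by (intro genideal_minimal L) auto
  moreover have "?L \<subseteq> initial_ideal (Suc s) ?J"
    unfolding initial_ideal_def
    using HJ by (intro subset_Idl_subset lead_monom_carrier Jc) auto
  ultimately show ?thesis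
    using J HJ G by (auto simp: groebner_basis_def)
qed

section \<open>Projective closure\<close>

lemma mpoly_eval_single: "mpoly_eval (single a c) x = c * (\<Prod>i\<in>keys a. x i ^ lookup a i)"
  by (simp add: mpoly_eval_def)

lemma mpoly_eval_add: "mpoly_eval (f + g) x = mpoly_eval f x + mpoly_eval g x"
  unfolding mpoly_eval_def
  by (rule setsum_keys_plus_distrib) (auto simp: distrib_right)

lemma mpoly_eval_sum: "mpoly_eval (sum h A) x = (\<Sum>i\<in>A. mpoly_eval (h i) x)"
  by (induction A rule: infinite_finite_induct) (auto simp: mpoly_eval_add, auto simp: mpoly_eval_def)

lemma mpoly_eval_dehom:
  assumes "\<forall>a\<in>keys F. mdeg a = d"
  shows "mpoly_eval (dehom s d F) x = mpoly_eval F (x(Suc s := 1))"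
proof -
  have "(\<Prod>i\<in>keys (dehom_expo s a). x i ^ lookup (dehom_expo s a) i) =
      (\<Prod>i\<in>keys a. (x(Suc s := 1)) i ^ lookup a i)" for a
    \<comment> \<open>The only index that can be missing on the left is that of \<open>u\<close>,
      whose factor is a power of 1.\<close>
    by (intro prod.mono_neutral_cong_left)
      (auto simp: in_keys_iff lookup_dehom_expo split: if_splits)
  then show ?thesis
    unfolding dehom_def mpoly_eval_sum mpoly_eval_def[of F] using assms
    by (intro sum.cong) (auto simp: mpoly_eval_single)
qed

lemma mpoly_eval_scale:
  assumes "\<forall>a\<in>keys F. mdeg a = d"
  shows "mpoly_eval F (\<lambda>i. c * x i) = c ^ d * mpoly_eval F x"
proof -
  have "(\<Prod>i\<in>keys a. (c * x i) ^ lookup a i) = c ^ mdeg a * (\<Prod>i\<in>keys a. x i ^ lookup a i)" for a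
    by (simp add: power_mult_distrib prod.distrib power_sum mdeg_def)
  then show ?thesis
    unfolding mpoly_eval_def sum_distrib_left using assms by (intro sum.cong) auto
qed

text \<open>Representatives of projective points are functions restricted to
  \<open>{1..Suc s}\<close>; this lets them be replaced by the unrestricted scaled vectors of
  \<open>mpoly_eval_scale\<close>.\<close>

lemma mpoly_eval_cong:
  assumes "F \<in> carrier (mpoly_ring m)" "\<And>i. i \<in> {1..m} \<Longrightarrow> x i = y i"
  shows "mpoly_eval F x = mpoly_eval F y"
  unfolding mpoly_eval_def using assms
  by (intro sum.cong arg_cong2[of _ _ _ _ "(*)"] prod.cong refl)
    (auto simp: mem_mpoly_ring_iff subset_iff)

lemma to_proj_self:
  assumes "x \<in> affine_space s"
  shows "x(Suc s := 1) \<in> to_proj s x"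
proof -
  have aff: "x(Suc s := 1) \<in> affine_space (Suc s)"
    using assms by (auto simp: affine_space_def PiE_iff extensional_def)
  moreover have "x(Suc s := 1) \<noteq> (\<lambda>i\<in>{1..Suc s}. 0)"
    by (auto dest: fun_cong[where x = "Suc s"])
  moreover have "x(Suc s := 1) = (\<lambda>i\<in>{1..Suc s}. 1 * (x(Suc s := 1)) i)"
    using aff by (auto simp: affine_space_def PiE_iff extensional_def)
  ultimately show ?thesis
    unfolding to_proj_def proj_point_def proj_rel_def
    by (auto intro!: exI[of _ 1])
qed

text \<open>The generators are compared: a form \<open>F\<close> in \<open>?V\<close> is a power of
  \<open>u\<close> times the homogenization of its value at u = 1, and conversely homogenizations of
  elements of \<open>?I\<close> vanish at every multiple of (x, 1).\<close>

lemma proj_vanishing_ideal_eq: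
  fixes X :: "(nat \<Rightarrow> 'k::field) set"
  assumes X: "X \<subseteq> affine_space s"
  shows "proj_vanishing_ideal s (to_proj s ` X) = homogenize_ideal s (vanishing_ideal s X)"
proof -
  interpret ring "mpoly_ring (Suc s) :: 'k mpol ring" by (rule ring_mpoly_ring)
  let ?I = "vanishing_ideal s X" and ?Y = "to_proj s ` X"
  let ?V = "{f \<in> carrier (mpoly_ring (Suc s)). homogeneous f \<and> (\<forall>P\<in>?Y. \<forall>z\<in>P. mpoly_eval f z = 0)}"
  have Ih: "homogenize s ` ?I \<subseteq> carrier (mpoly_ring (Suc s))"
    using homogenize_carrier by (auto simp: vanishing_ideal_def)
  have J: "ideal (homogenize_ideal s ?I) (mpoly_ring (Suc s))"
    unfolding homogenize_ideal_def by (rule genideal_ideal[OF Ih])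
  have "?V \<subseteq> homogenize_ideal s ?I"
  proof
    fix F assume F: "F \<in> ?V"
    then obtain d where d: "\<forall>a\<in>keys F. mdeg a = d"
      by (auto simp: homogeneous_def)
    let ?g = "dehom s d F"
    have "mpoly_eval ?g x = 0" if "x \<in> X" for x
      using F X that to_proj_self[of x s] by (force simp: mpoly_eval_dehom[OF d])
    then have g: "?g \<in> ?I"
      using F by (simp add: vanishing_ideal_def dehom_carrier)
    show "F \<in> homogenize_ideal s ?I"
    proof (cases "?g = 0")
      \<comment> \<open>Treated apart because \<open>tdeg\<close> is meaningless for 0; here
        \<open>F\<close> itself is 0.\<close>
      case True
      then show ?thesis
        using homog_dehom[OF d, of s] ideal_mpoly_zero[OF J] by simp
    next
      case False
      obtain a where "a \<in> keys F" "mdeg a = d" "lead_expo ?g = dehom_expo s a"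
        using lead_expo_in_keys[OF False] by (auto simp: keys_dehom)
      \<comment> \<open>The leading exponent of \<open>?g\<close> arises from an exponent of degree
        \<open>d\<close> by dropping \<open>u\<close>.\<close>
      then have "tdeg ?g \<le> d"
        using mdeg_dehom_expo[of s a] False by (simp add: tdeg_eq_mdeg_lead_expo)
      then have "F = single (single (Suc s) (d - tdeg ?g)) 1 * homogenize s ?g"
        using homog_raise_degree homog_dehom[OF d] by metis
      also have "\<dots> \<in> homogenize_ideal s ?I"
      proof (rule ideal_mpoly_term[OF J])
        show "homogenize s ?g \<in> homogenize_ideal s ?I"
          unfolding homogenize_ideal_def using genideal_self[OF Ih] g by blast
      qed auto
      finally show ?thesis .
    qed
  qed
  moreover have "homogenize s ` ?I \<subseteq> ?V"
  proof (intro image_subsetI CollectI conjI ballI)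
    fix f assume f: "f \<in> ?I"
    then have fc: "f \<in> carrier (mpoly_ring s)"
      by (simp add: vanishing_ideal_def)
    then show hc: "homogenize s f \<in> carrier (mpoly_ring (Suc s))"
      by (rule homogenize_carrier)
    have d: "\<forall>a\<in>keys (homogenize s f). mdeg a = tdeg f"
      using fc by (auto simp: homogenize_eq_homog keys_homog mdeg_homog_expo mdeg_le_tdeg)
    then show "homogeneous (homogenize s f)"
      by (auto simp: homogeneous_def)
    fix P z assume "P \<in> ?Y" "z \<in> P"
    then obtain x c where x: "x \<in> X" and z: "z = (\<lambda>i\<in>{1..Suc s}. c * (x(Suc s := 1)) i)"
      by (auto simp: to_proj_def proj_point_def proj_rel_def)
    have "mpoly_eval (homogenize s f) z = mpoly_eval (homogenize s f) (\<lambda>i. c * (x(Suc s := 1)) i)"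
      by (rule mpoly_eval_cong[OF hc]) (simp add: z)
    also have "\<dots> = c ^ tdeg f * mpoly_eval (homogenize s f) (x(Suc s := 1))"
      by (rule mpoly_eval_scale[OF d])
    also have "mpoly_eval (homogenize s f) (x(Suc s := 1)) = mpoly_eval f x"
      using mpoly_eval_dehom[OF d, of s x] dehom_homog[OF fc order_refl, of "tdeg f"]
      by (simp add: homogenize_eq_homog)
    also have "\<dots> = 0"
      using f x by (simp add: vanishing_ideal_def)
    finally show "mpoly_eval (homogenize s f) z = 0" by simp
  qed
  moreover have "?V \<subseteq> carrier (mpoly_ring (Suc s))"
    by blast
  ultimately show ?thesis
    unfolding proj_vanishing_ideal_def
    using genideal_minimal[OF J, of ?V] subset_Idl_subset[of ?V "homogenize s ` ?I"]
    by (intro equalityI) (simp_all only: homogenize_ideal_def)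
qed

lemma toric_set_subset: "toric_set s n v \<subseteq> affine_space s"
  by (auto simp: toric_set_def affine_space_def)

theorem lemma3p7:
  fixes s n r :: nat
    and v :: "nat \<Rightarrow> nat \<Rightarrow> nat"
    and f :: "nat \<Rightarrow> ('k::{field,finite}) mpol"
  assumes "groebner_basis s (vanishing_ideal s (toric_set s n v)) (f ` {1..r})"
  shows "groebner_basis (Suc s)
           (Idl\<^bsub>mpoly_ring (Suc s)\<^esub> ((\<lambda>i. homogenize s (f i)) ` {1..r}))
           ((\<lambda>i. homogenize s (f i)) ` {1..r})
       \<and> proj_vanishing_ideal s (to_proj s ` toric_set s n v)
           = homogenize_ideal s (vanishing_ideal s (toric_set s n v))
       \<and> homogenize_ideal s (vanishing_ideal s (toric_set s n v))
           = Idl\<^bsub>mpoly_ring (Suc s)\<^esub> ((\<lambda>i. homogenize s (f i)) ` {1..r})"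
  using groebner_basis_homogenize[OF assms] homogenize_ideal_eq_Idl[OF assms]
    proj_vanishing_ideal_eq[OF toric_set_subset[of s n v]]
  by (simp add: image_image)

end
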